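(* Let $\Sigma_f$ be a rotational Ricci surface in $\mathbb{R}^3$ with negative Gaussian curvature, where $f:\mathbb{R}\to\left(-\frac ca,+\infty\right)$ is a positive smooth function defined implicitly by $$af(s)-c\log\left(af(s)+c\right)=a^2s+d$$ for $a,c,d\in\mathbb{R}$ with $0<a\le1$ and $c<0$. Then: 1. $\Sigma_f$ is a proper surface; 2. $\Sigma_f$ is asymptotic to the cylinder $\mathcal{C}_0\left(-\frac ca\right)$ when $s\to-\infty$.
   Context: Rotational surfaces: let $I\subseteq\mathbb{R}$ be an open interval, and let $f,g:I\to\mathbb{R}$ be smooth with $f>0$, $(f')^2+(g')^2=1$ and $g'\ge 0$. The rotational surface $\Sigma_f\subset\mathbb{R}^3$ is the surface parametrised by $X(s,\theta)=(f(s)\cos\theta,f(s)\sin\theta,g(s))$. Up to a vertical isometry of $\mathbb{R}^3$, $g(s)=\int_{s_0}^s\sqrt{1-f'(\zeta)^2}\,d\zeta$ with $s_0\in I$, so $\Sigma_f$ is determined by $f$. The induced metric is $ds^2+f(s)^2d\theta^2$ and the Gaussian curvature is $K=-f''/f$. A rotational Ricci surface is a rotational surface $\Sigma_f$ whose Gaussian curvature satisfies the Ricci condition $K\Delta K-\|\nabla K\|^2-4K^3=0$, equivalently $KK''-(K')^2-4K^3+\frac{f'}{f}KK'=0$ with $K=-f''/f$. $\mathcal{C}_0(r)$ denotes the right circular cylinder of radius $r>0$ about the $z$-axis. "$\Sigma_f$ is asymptotic to $\mathcal{C}_0(r)$ when $s\to-\infty$" means that $f(s)\to r$ and $g(s)\to-\infty$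 as $s\to-\infty$. *)

theory Defs
  imports "HOL-Analysis.Analysis"
begin

section \<open>Parametrised surfaces in Euclidean space\<close>

text \<open>
  A parametrised surface is a curried map \<open>X s t\<close>. The scalar functions on it are likewise
  functions of the two parameters. The prefix \<open>fff\<close> stands for first fundamental form.
\<close>

definition partial1 :: "(real \<Rightarrow> real \<Rightarrow> 'a::real_normed_vector) \<Rightarrow> real \<Rightarrow> real \<Rightarrow> 'a" where
  "partial1 h s t = vector_derivative (\<lambda>x. h x t) (at s)"

definition partial2 :: "(real \<Rightarrow> real \<Rightarrow> 'a::real_normed_vector) \<Rightarrow> real \<Rightarrow> real \<Rightarrow> 'a" where
  "partial2 h s t = vector_derivative (\<lambda>y. h s y) (at t)"

definition fff_E :: "(real \<Rightarrow> real \<Rightarrow> real^3) \<Rightarrow> real \<Rightarrow> real \<Rightarrow> real" where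
  "fff_E X s t = partial1 X s t \<bullet> partial1 X s t"

definition fff_F :: "(real \<Rightarrow> real \<Rightarrow> real^3) \<Rightarrow> real \<Rightarrow> real \<Rightarrow> real" where
  "fff_F X s t = partial1 X s t \<bullet> partial2 X s t"

definition fff_G :: "(real \<Rightarrow> real \<Rightarrow> real^3) \<Rightarrow> real \<Rightarrow> real \<Rightarrow> real" where
  "fff_G X s t = partial2 X s t \<bullet> partial2 X s t"

definition fff_det :: "(real \<Rightarrow> real \<Rightarrow> real^3) \<Rightarrow> real \<Rightarrow> real \<Rightarrow> real" where
  "fff_det X s t = fff_E X s t * fff_G X s t - (fff_F X s t)\<^sup>2"

definition unit_normal :: "(real \<Rightarrow> real \<Rightarrow> real^3) \<Rightarrow> real \<Rightarrow> real \<Rightarrow> real^3" where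
  "unit_normal X s t = sgn (cross3 (partial1 X s t) (partial2 X s t))"

definition gauss_curvature :: "(real \<Rightarrow> real \<Rightarrow> real^3) \<Rightarrow> real \<Rightarrow> real \<Rightarrow> real" where
  "gauss_curvature X s t =
     ((partial1 (partial1 X) s t \<bullet> unit_normal X s t) * (partial2 (partial2 X) s t \<bullet> unit_normal X s t)
       - (partial1 (partial2 X) s t \<bullet> unit_normal X s t)\<^sup>2) / fff_det X s t"

text \<open>
  The squared norm of the gradient and the Laplace-Beltrami operator of the induced metric, in
  local coordinates. The sign of the Laplacian is the one with \<open>\<Delta> = div \<circ> grad\<close>.
\<close>

definition grad_norm_sq ::
  "(real \<Rightarrow> real \<Rightarrow> real^3) \<Rightarrow> (real \<Rightarrow> real \<Rightarrow> real) \<Rightarrow> real \<Rightarrow> real \<Rightarrow> real" where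
  "grad_norm_sq X h s t =
     (fff_G X s t * (partial1 h s t)\<^sup>2 - 2 * fff_F X s t * partial1 h s t * partial2 h s t
       + fff_E X s t * (partial2 h s t)\<^sup>2) / fff_det X s t"

definition laplace_beltrami ::
  "(real \<Rightarrow> real \<Rightarrow> real^3) \<Rightarrow> (real \<Rightarrow> real \<Rightarrow> real) \<Rightarrow> real \<Rightarrow> real \<Rightarrow> real" where
  "laplace_beltrami X h s t =
     (partial1 (\<lambda>x y. (fff_G X x y * partial1 h x y - fff_F X x y * partial2 h x y)
                        / sqrt (fff_det X x y)) s t
      + partial2 (\<lambda>x y. (fff_E X x y * partial2 h x y - fff_F X x y * partial1 h x y)
                        / sqrt (fff_det X x y)) s t)
     / sqrt (fff_det X s t)"

definition ricci_condition_at :: "(real \<Rightarrow> real \<Rightarrow> real^3) \<Rightarrow> real \<Rightarrow> real \<Rightarrow> bool" where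
  "ricci_condition_at X s t \<longleftrightarrow>
     gauss_curvature X s t * laplace_beltrami X (gauss_curvature X) s t
       - grad_norm_sq X (gauss_curvature X) s t - 4 * (gauss_curvature X s t) ^ 3 = 0"


section \<open>Rotational surfaces\<close>

text \<open>Smoothness on an open set of reals.\<close>

definition smooth_on :: "real set \<Rightarrow> (real \<Rightarrow> real) \<Rightarrow> bool" where
  "smooth_on I h \<longleftrightarrow> (\<forall>n. \<forall>x\<in>I. (deriv ^^ n) h field_differentiable at x)"

definition rot_param :: "(real \<Rightarrow> real) \<Rightarrow> (real \<Rightarrow> real) \<Rightarrow> real \<Rightarrow> real \<Rightarrow> real^3" where
  "rot_param f g s \<theta> = vector [f s * cos \<theta>, f s * sin \<theta>, g s]"

definition rotational_surface :: "real set \<Rightarrow> (real \<Rightarrow> real) \<Rightarrow> (real \<Rightarrow> real) \<Rightarrow> bool" where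
  "rotational_surface I f g \<longleftrightarrow>
     open I \<and> is_interval I \<and> I \<noteq> {} \<and> smooth_on I f \<and> smooth_on I g \<and>
     (\<forall>s\<in>I. f s > 0 \<and> (deriv f s)\<^sup>2 + (deriv g s)\<^sup>2 = 1 \<and> deriv g s \<ge> 0)"

definition rotational_ricci_surface :: "real set \<Rightarrow> (real \<Rightarrow> real) \<Rightarrow> (real \<Rightarrow> real) \<Rightarrow> bool" where
  "rotational_ricci_surface I f g \<longleftrightarrow>
     rotational_surface I f g \<and> (\<forall>s\<in>I. \<forall>\<theta>. ricci_condition_at (rot_param f g) s \<theta>)"

text \<open>
  Since \<open>rot_param\<close> is periodic in the angle it is never a proper map. The surface itself is the
  cylinder \<open>I \<times> S\<^sup>1\<close>, immersed by the map that \<open>rot_param\<close> induces on the quotient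
  (see \<open>rot_immersion_cis\<close>). Properness is that of this immersion.
\<close>

definition rot_immersion :: "(real \<Rightarrow> real) \<Rightarrow> (real \<Rightarrow> real) \<Rightarrow> real \<times> complex \<Rightarrow> real^3" where
  "rot_immersion f g = (\<lambda>(s, u). vector [f s * Re u, f s * Im u, g s])"

definition proper_rotational_surface :: "real set \<Rightarrow> (real \<Rightarrow> real) \<Rightarrow> (real \<Rightarrow> real) \<Rightarrow> bool" where
  "proper_rotational_surface I f g \<longleftrightarrow>
     proper_map (top_of_set (I \<times> sphere 0 1)) euclidean (rot_immersion f g)"

definition asymptotic_to_cylinder_at_bot :: "(real \<Rightarrow> real) \<Rightarrow> (real \<Rightarrow> real) \<Rightarrow> real \<Rightarrow> bool" where
  "asymptotic_to_cylinder_at_bot f g r \<longleftrightarrow> (f \<longlongrightarrow> r) at_bot \<and> filterlim g at_bot at_bot"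


section \<open>Agreement with the classical formulas\<close>

lemma rot_immersion_cis: "rot_immersion f g (s, cis \<theta>) = rot_param f g s \<theta>"
  by (simp add: rot_immersion_def rot_param_def)

lemma has_vector_derivative_vector_3:
  assumes "(a has_real_derivative a') (at x)" "(b has_real_derivative b') (at x)"
    "(c has_real_derivative c') (at x)"
  shows "((\<lambda>x. vector [a x, b x, c x] :: real^3) has_vector_derivative vector [a', b', c']) (at x)"
proof -
  have eq: "vector [p, q, r] = p *\<^sub>R axis 1 1 + q *\<^sub>R axis 2 1 + r *\<^sub>R (axis 3 1 :: real^3)" for p q r
    by (simp add: vec_eq_iff forall_3 axis_def)
  show ?thesis
    unfolding eq
    by (intro has_vector_derivative_add)
       (use assms in \<open>auto intro!: derivative_eq_intros
          simp: has_real_derivative_iff_has_vector_derivative\<close>)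
qed

lemma partial1_eqI:
  assumes "open I" "s \<in> I" "\<And>x. x \<in> I \<Longrightarrow> h x t = k x"
    "(k has_vector_derivative v) (at s)"
  shows "partial1 h s t = v"
  unfolding partial1_def
  by (intro vector_derivative_at has_vector_derivative_transform_within_open[OF assms(4,1,2)])
     (simp add: assms(3))

lemma partial2_eqI:
  assumes "\<And>y. h s y = k y" "(k has_vector_derivative v) (at t)"
  shows "partial2 h s t = v"
proof -
  have "h s = k"
    using assms(1) by (rule ext)
  thus ?thesis
    using assms(2) by (simp add: partial2_def vector_derivative_at)
qed

lemma sin_sin_mult: "sin t * (sin t * z) = z - cos t * (cos t * z)" for t z :: real
proof -
  have "sin t * (sin t * z) = (sin t)\<^sup>2 * z"
    by (simp add: power2_eq_square)
  also have "\<dots> = z - cos t * (cos t * z)"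
    unfolding sin_squared_eq by (simp add: power2_eq_square left_diff_distrib)
  finally show ?thesis .
qed

context
  fixes I f g
  assumes rot: "rotational_surface I f g"
begin

lemma rot_open: "open I"
  using rot by (simp add: rotational_surface_def)

lemma rot_pos: "s \<in> I \<Longrightarrow> f s > 0"
  using rot by (simp add: rotational_surface_def)

lemma rot_unit: "s \<in> I \<Longrightarrow> (deriv f s)\<^sup>2 + (deriv g s)\<^sup>2 = 1"
  using rot by (simp add: rotational_surface_def)

lemma rot_DERIV_n:
  assumes "s \<in> I"
  shows "((deriv ^^ n) f has_real_derivative (deriv ^^ Suc n) f s) (at s)"
    "((deriv ^^ n) g has_real_derivative (deriv ^^ Suc n) g s) (at s)"
  using rot assms
  by (auto simp: rotational_surface_def smooth_on_def DERIV_deriv_iff_field_differentiable)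

lemmas rot_DERIV =
  rot_DERIV_n[where n=0, simplified] rot_DERIV_n[where n="Suc 0", simplified]

lemma rot_partial1:
  "s \<in> I \<Longrightarrow> partial1 (rot_param f g) s t = vector [deriv f s * cos t, deriv f s * sin t, deriv g s]"
  by (rule partial1_eqI[OF rot_open, of _ _ _ "\<lambda>s. rot_param f g s t"])
     (auto simp: rot_param_def intro!: has_vector_derivative_vector_3 derivative_eq_intros rot_DERIV)

lemma rot_partial2:
  "partial2 (rot_param f g) s t = vector [- f s * sin t, f s * cos t, 0]"
  by (rule partial2_eqI[of _ _ "\<lambda>t. rot_param f g s t"])
     (auto simp: rot_param_def intro!: has_vector_derivative_vector_3 derivative_eq_intros)

lemma rot_partial11:
  "s \<in> I \<Longrightarrow> partial1 (partial1 (rot_param f g)) s t =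
     vector [deriv (deriv f) s * cos t, deriv (deriv f) s * sin t, deriv (deriv g) s]"
  by (rule partial1_eqI[OF rot_open _ rot_partial1])
     (auto intro!: has_vector_derivative_vector_3 derivative_eq_intros rot_DERIV)

lemma rot_partial12:
  "s \<in> I \<Longrightarrow> partial1 (partial2 (rot_param f g)) s t =
     vector [- deriv f s * sin t, deriv f s * cos t, 0]"
  by (rule partial1_eqI[OF rot_open _ rot_partial2])
     (auto intro!: has_vector_derivative_vector_3 derivative_eq_intros rot_DERIV)

lemma rot_partial22:
  "partial2 (partial2 (rot_param f g)) s t = vector [- f s * cos t, - f s * sin t, 0]"
  by (rule partial2_eqI[OF rot_partial2])
     (auto intro!: has_vector_derivative_vector_3 derivative_eq_intros)

lemma rot_fff:
  assumes "s \<in> I"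
  shows "fff_E (rot_param f g) s t = 1" "fff_F (rot_param f g) s t = 0"
    "fff_G (rot_param f g) s t = (f s)\<^sup>2" "fff_det (rot_param f g) s t = (f s)\<^sup>2"
proof -
  show E: "fff_E (rot_param f g) s t = 1"
    using rot_unit[OF assms]
    by (simp add: fff_E_def rot_partial1[OF assms] inner_vec_def sum_3 power2_eq_square)
       (simp add: algebra_simps sin_sin_mult)
  show F: "fff_F (rot_param f g) s t = 0"
    by (simp add: fff_F_def rot_partial1[OF assms] rot_partial2 inner_vec_def sum_3)
  show G: "fff_G (rot_param f g) s t = (f s)\<^sup>2"
    by (simp add: fff_G_def rot_partial2 inner_vec_def sum_3 power2_eq_square)
       (simp add: algebra_simps sin_sin_mult)
  show "fff_det (rot_param f g) s t = (f s)\<^sup>2"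
    by (simp add: fff_det_def E F G)
qed

lemma rot_unit_normal:
  assumes "s \<in> I"
  shows "unit_normal (rot_param f g) s t =
    vector [- deriv g s * cos t, - deriv g s * sin t, deriv f s]"
proof -
  let ?n = "vector [- deriv g s * cos t, - deriv g s * sin t, deriv f s] :: real^3"
  have "?n \<bullet> ?n = 1"
    using rot_unit[OF assms]
    by (simp add: inner_vec_def sum_3 power2_eq_square) (simp add: algebra_simps sin_sin_mult)
  hence n: "norm ?n = 1"
    by (simp add: norm_eq_sqrt_inner)
  have "cross3 (partial1 (rot_param f g) s t) (partial2 (rot_param f g) s t) = f s *\<^sub>R ?n"
    by (simp add: rot_partial1[OF assms] rot_partial2 cross3_def vec_eq_iff forall_3)
       (simp add: algebra_simps sin_sin_mult)
  thus ?thesis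
    using rot_pos[OF assms] n by (simp add: unit_normal_def sgn_div_norm)
qed

lemma rot_gauss_curvature:
  assumes "s \<in> I"
  shows "gauss_curvature (rot_param f g) s t = - deriv (deriv f) s / f s"
proof -
  let ?N = "unit_normal (rot_param f g) s t"
  have L: "partial1 (partial1 (rot_param f g)) s t \<bullet> ?N
      = deriv f s * deriv (deriv g) s - deriv g s * deriv (deriv f) s"
    by (simp add: rot_partial11[OF assms] rot_unit_normal[OF assms] inner_vec_def sum_3)
       (simp add: algebra_simps sin_sin_mult)
  have M: "partial1 (partial2 (rot_param f g)) s t \<bullet> ?N = 0"
    by (simp add: rot_partial12[OF assms] rot_unit_normal[OF assms] inner_vec_def sum_3)
  have N: "partial2 (partial2 (rot_param f g)) s t \<bullet> ?N = f s * deriv g s"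
    by (simp add: rot_partial22 rot_unit_normal[OF assms] inner_vec_def sum_3)
       (simp add: algebra_simps sin_sin_mult)
  have "((\<lambda>s. (deriv f s)\<^sup>2 + (deriv g s)\<^sup>2) has_real_derivative 0) (at s)"
    by (rule has_field_derivative_transform_within_open[of "\<lambda>_. 1", OF _ rot_open assms])
       (simp_all add: rot_unit)
  moreover have "((\<lambda>s. (deriv f s)\<^sup>2 + (deriv g s)\<^sup>2) has_real_derivative
      2 * (deriv f s * deriv (deriv f) s + deriv g s * deriv (deriv g) s)) (at s)"
    using assms by (auto intro!: derivative_eq_intros rot_DERIV)
  ultimately have 0: "deriv g s * deriv (deriv g) s = - (deriv f s * deriv (deriv f) s)"
    using DERIV_unique by fastforce
  have "(deriv f s * deriv (deriv g) s - deriv g s * deriv (deriv f) s) * deriv g s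
      = deriv f s * (deriv g s * deriv (deriv g) s) - (deriv g s)\<^sup>2 * deriv (deriv f) s"
    by (simp add: algebra_simps power2_eq_square)
  also have "\<dots> = - (((deriv f s)\<^sup>2 + (deriv g s)\<^sup>2) * deriv (deriv f) s)"
    unfolding 0 by (simp add: algebra_simps power2_eq_square)
  also have "\<dots> = - deriv (deriv f) s"
    by (simp add: rot_unit[OF assms])
  finally have "(deriv f s * deriv (deriv g) s - deriv g s * deriv (deriv f) s) * (f s * deriv g s)
      = - deriv (deriv f) s * f s"
    by (metis mult.assoc mult.commute)
  thus ?thesis
    using rot_pos[OF assms]
    by (simp add: gauss_curvature_def L M N rot_fff[OF assms] power2_eq_square)
qed

lemma rot_ricci_condition_iff:
  fixes K defines "K \<equiv> \<lambda>s. - deriv (deriv f) s / f s"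
  assumes s: "s \<in> I"
  shows "ricci_condition_at (rot_param f g) s t \<longleftrightarrow>
    K s * deriv (deriv K) s - (deriv K s)\<^sup>2 - 4 * K s ^ 3 + deriv f s / f s * K s * deriv K s = 0"
proof -
  let ?X = "rot_param f g"
  let ?K' = "\<lambda>x. - (deriv (deriv (deriv f)) x * f x - deriv (deriv f) x * deriv f x) / (f x * f x)"
  have K_eq: "gauss_curvature ?X x y = K x" if "x \<in> I" for x y
    by (simp add: K_def rot_gauss_curvature that)
  have f3: "(deriv (deriv f) has_real_derivative deriv (deriv (deriv f)) x) (at x)"
    and f4: "(deriv (deriv (deriv f)) has_real_derivative deriv (deriv (deriv (deriv f))) x) (at x)"
    if "x \<in> I" for x
    using rot_DERIV_n(1)[OF that, of 2] rot_DERIV_n(1)[OF that, of 3]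
    by (simp_all add: numeral_eq_Suc)
  have K': "(K has_real_derivative ?K' x) (at x)" if "x \<in> I" for x
    unfolding K_def
    using that rot_pos[OF that]
    by (auto intro!: derivative_eq_intros rot_DERIV f3 simp: field_simps)
  hence dK: "deriv K x = ?K' x" if "x \<in> I" for x
    using that by (simp add: DERIV_imp_deriv)
  have "?K' field_differentiable at s"
    unfolding field_differentiable_def using s rot_pos[OF s]
    by (intro exI) (rule derivative_eq_intros rot_DERIV f3 f4 refl | simp)+
  then obtain D where D: "(?K' has_real_derivative D) (at s)"
    by (auto simp: field_differentiable_def)
  have K'': "(deriv K has_real_derivative D) (at s)"
    by (rule has_field_derivative_transform_within_open[OF D rot_open s]) (simp add: dK)
  hence dD: "deriv (deriv K) s = D"
    by (simp add: DERIV_imp_deriv)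
  have p1: "partial1 (gauss_curvature ?X) x y = deriv K x" if "x \<in> I" for x y
    by (rule partial1_eqI[OF rot_open that, of _ _ K])
       (use that K'[OF that] in \<open>simp_all add: K_eq dK
          flip: has_real_derivative_iff_has_vector_derivative\<close>)
  have p2: "partial2 (gauss_curvature ?X) x y = 0" if "x \<in> I" for x y
    by (rule partial2_eqI[of _ _ "\<lambda>_. K x"]) (use that in \<open>auto simp: K_eq\<close>)
  have sq: "sqrt (fff_det ?X x y) = f x" if "x \<in> I" for x y
    using rot_pos[OF that] by (simp add: rot_fff[OF that])
  have a: "partial1 (\<lambda>x y. (fff_G ?X x y * partial1 (gauss_curvature ?X) x y
      - fff_F ?X x y * partial2 (gauss_curvature ?X) x y) / sqrt (fff_det ?X x y)) s t
      = deriv f s * deriv K s + f s * D"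
  proof (rule partial1_eqI[OF rot_open s, of _ _ "\<lambda>x. f x * deriv K x"])
    show "((\<lambda>x. f x * deriv K x) has_vector_derivative deriv f s * deriv K s + f s * D) (at s)"
      unfolding has_real_derivative_iff_has_vector_derivative[symmetric]
      using s by (auto intro!: derivative_eq_intros rot_DERIV K'')
  next
    fix x assume "x \<in> I"
    thus "(fff_G ?X x t * partial1 (gauss_curvature ?X) x t
      - fff_F ?X x t * partial2 (gauss_curvature ?X) x t) / sqrt (fff_det ?X x t) = f x * deriv K x"
      using rot_pos[of x] by (simp add: sq p1 p2 rot_fff power2_eq_square)
  qed
  have b: "partial2 (\<lambda>x y. (fff_E ?X x y * partial2 (gauss_curvature ?X) x y
      - fff_F ?X x y * partial1 (gauss_curvature ?X) x y) / sqrt (fff_det ?X x y)) s t = 0"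
    by (rule partial2_eqI[of _ _ "\<lambda>_. 0"]) (auto simp: s p2 rot_fff)
  have "laplace_beltrami ?X (gauss_curvature ?X) s t = deriv f s / f s * deriv K s + D"
    unfolding laplace_beltrami_def a b using rot_pos[OF s] by (simp add: sq s field_simps)
  moreover have "grad_norm_sq ?X (gauss_curvature ?X) s t = (deriv K s)\<^sup>2"
    unfolding grad_norm_sq_def using rot_pos[OF s] by (simp add: s p1 p2 rot_fff)
  moreover have "gauss_curvature ?X s t = K s"
    by (simp add: rot_gauss_curvature[OF s] K_def)
  ultimately show ?thesis
    by (simp add: ricci_condition_at_def dD algebra_simps)
qed

lemma rot_immersion_continuous: "continuous_on (I \<times> sphere 0 1) (rot_immersion f g)"
proof -
  have eq: "vector [p, q, r] = p *\<^sub>R axis 1 1 + q *\<^sub>R axis 2 1 + r *\<^sub>R (axis 3 1 :: real^3)" for p q r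
    by (simp add: vec_eq_iff forall_3 axis_def)
  have "continuous_on I f" "continuous_on I g"
    by (auto intro!: continuous_at_imp_continuous_on intro: DERIV_isCont rot_DERIV)
  hence "continuous_on (I \<times> sphere (0::complex) 1) (\<lambda>x. f (fst x))"
    "continuous_on (I \<times> sphere (0::complex) 1) (\<lambda>x. g (fst x))"
    by (auto intro!: continuous_on_compose2[of I _ _ fst] continuous_intros)
  thus ?thesis
    unfolding rot_immersion_def case_prod_unfold eq by (intro continuous_intros)
qed

lemma proper_rotational_surface_iff_compact:
  "proper_rotational_surface I f g \<longleftrightarrow>
     (\<forall>C. compact C \<longrightarrow> compact {p \<in> I \<times> sphere 0 1. rot_immersion f g p \<in> C})"
proof -
  have "continuous_map (top_of_set (I \<times> sphere 0 1)) euclidean (rot_immersion f g)"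
    using rot_immersion_continuous by simp
  moreover have "k_space (euclidean :: (real^3) topology)" "kc_space (euclidean :: (real^3) topology)"
    by (simp_all add: metrizable_imp_k_space Hausdorff_imp_kc_space metrizable_space_euclidean)
  ultimately show ?thesis
    by (simp add: proper_rotational_surface_def proper_eq_compact_map compactin_subtopology
        subset_eq)
qed

end

end

theory Submission
  imports Defs
begin

text \<open>
  Differentiating the implicit equation gives \<open>f' = a + c / f\<close>. Since \<open>a f > 0\<close>, the equation also
  gives \<open>ln (a f + c) \<le> (a\<^sup>2 s + d) / (- c)\<close>, so \<open>f \<rightarrow> - c / a\<close> and hence \<open>f' \<rightarrow> 0\<close> as
  \<open>s \<rightarrow> -\<infinity>\<close>. Then \<open>g'\<close> is eventually at least \<open>1/2\<close>, which forces \<open>g \<rightarrow> -\<infinity>\<close>.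
  The preimage of a compact set is closed, and \<open>s\<close> is bounded on it: from below because \<open>g\<close> is,
  from above because \<open>f\<close> is and \<open>s\<close> is an increasing function of \<open>f\<close>.
\<close>

text \<open>Left of some \<open>S\<close> the function \<open>g s - k * s\<close> is nondecreasing,
  so there \<open>g\<close> stays below a line of positive slope \<open>k\<close>.\<close>

lemma filterlim_at_bot_at_bot_if_deriv_ge:
  fixes g g' :: "real \<Rightarrow> real"
  assumes g: "\<And>s. (g has_real_derivative g' s) (at s)"
    and k: "k > 0" "\<forall>\<^sub>F s in at_bot. k \<le> g' s"
  shows "filterlim g at_bot at_bot"
proof -
  obtain S where S: "\<And>s. s \<le> S \<Longrightarrow> k \<le> g' s"
    using k(2) by (auto simp: eventually_at_bot_linorder)
  have "g s \<le> k * s + (g S - k * S)" if "s \<le> S" for s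
  proof -
    have "g s - k * s \<le> g S - k * S"
    proof (rule DERIV_nonneg_imp_nondecreasing[OF that])
      fix x assume "x \<le> S"
      moreover have "((\<lambda>x. g x - k * x) has_real_derivative g' x - k) (at x)"
        by (auto intro!: derivative_eq_intros g)
      ultimately show "\<exists>y. ((\<lambda>x. g x - k * x) has_real_derivative y) (at x) \<and> 0 \<le> y"
        using S[of x] by force
    qed
    thus ?thesis by simp
  qed
  hence le: "\<forall>\<^sub>F s in at_bot. g s \<le> k * s + (g S - k * S)"
    by (auto simp: eventually_at_bot_linorder)
  have lim: "filterlim (\<lambda>s. k * s + (g S - k * S)) at_bot at_bot"
    unfolding filterlim_at_bot
  proof
    fix Z
    have "k * s + (g S - k * S) \<le> Z" if "s \<le> (Z - (g S - k * S)) / k" for s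
      using that k(1) by (simp add: field_simps)
    thus "\<forall>\<^sub>F s in at_bot. k * s + (g S - k * S) \<le> Z"
      by (auto simp: eventually_at_bot_linorder)
  qed
  show ?thesis
    unfolding filterlim_at_bot
  proof
    fix Z
    have "\<forall>\<^sub>F s in at_bot. k * s + (g S - k * S) \<le> Z"
      using lim by (simp add: filterlim_at_bot)
    with le show "\<forall>\<^sub>F s in at_bot. g s \<le> Z"
      by eventually_elim (rule order_trans)
  qed
qed

lemma norm_rot_immersion_sq:
  assumes "norm u = 1"
  shows "(norm (rot_immersion f g (s, u)))\<^sup>2 = (f s)\<^sup>2 + (g s)\<^sup>2"
proof -
  have "(norm (rot_immersion f g (s, u)))\<^sup>2 = (f s)\<^sup>2 * ((Re u)\<^sup>2 + (Im u)\<^sup>2) + (g s)\<^sup>2"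
    unfolding power2_norm_eq_inner
    by (simp add: rot_immersion_def inner_vec_def sum_3 power2_eq_square algebra_simps)
  also have "(Re u)\<^sup>2 + (Im u)\<^sup>2 = 1"
    using assms by (simp flip: cmod_power2)
  finally show ?thesis by simp
qed

text \<open>The circle factor is compact, so a point of the domain can escape only through
  \<open>s\<close>. A bound on the image bounds both \<open>f\<close> and \<open>g\<close>, by the
  norm identity above.\<close>

lemma proper_rotational_surfaceI:
  assumes rot: "rotational_surface UNIV f g"
    and bd: "\<And>M. bounded {s. \<bar>f s\<bar> \<le> M \<and> \<bar>g s\<bar> \<le> M}"
  shows "proper_rotational_surface UNIV f g"
  unfolding proper_rotational_surface_iff_compact[OF rot]
proof (intro allI impI)
  fix C :: "(real^3) set" assume C: "compact C"
  let ?P = "{p \<in> UNIV \<times> sphere 0 1. rot_immersion f g p \<in> C}"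
  \<comment> \<open>The preimage is closed relative to the domain; as the domain is itself closed,
    it is closed in the ambient product.\<close>
  have "closed ((UNIV :: real set) \<times> sphere (0::complex) 1)"
    by (intro closed_Times) auto
  hence "closed ?P"
    using continuous_closed_preimage[OF rot_immersion_continuous[OF rot] _ compact_imp_closed[OF C]]
    by (simp add: vimage_def Int_def)
  moreover have "bounded ?P"
  proof -
    obtain M where M: "M > 0" "\<And>x. x \<in> C \<Longrightarrow> norm x \<le> M"
      using compact_imp_bounded[OF C] by (auto simp: bounded_pos)
    have "\<bar>f s\<bar> \<le> M \<and> \<bar>g s\<bar> \<le> M" if "norm u = 1" "rot_immersion f g (s, u) \<in> C" for s u
    proof -
      have "(f s)\<^sup>2 + (g s)\<^sup>2 \<le> M\<^sup>2"
        using M(2)[OF that(2)] norm_rot_immersion_sq[OF that(1), of f g s]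
        by (metis norm_ge_zero power_mono)
      hence "(f s)\<^sup>2 \<le> M\<^sup>2" "(g s)\<^sup>2 \<le> M\<^sup>2"
        using zero_le_power2[of "f s"] zero_le_power2[of "g s"] by linarith+
      thus ?thesis
        using M(1) by (simp add: abs_le_square_iff[symmetric])
    qed
    hence "?P \<subseteq> {s. \<bar>f s\<bar> \<le> M \<and> \<bar>g s\<bar> \<le> M} \<times> sphere 0 1"
      by auto
    thus ?thesis
      by (rule bounded_subset[OF bounded_Times[OF bd bounded_sphere]])
  qed
  ultimately show "compact ?P"
    by (simp add: compact_eq_bounded_closed)
qed

theorem theorem3p7:
  fixes f g :: "real \<Rightarrow> real" and a c d :: real
  assumes "rotational_ricci_surface UNIV f g"
    and "\<forall>s \<theta>. gauss_curvature (rot_param f g) s \<theta> < 0"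
    and "0 < a" and "a \<le> 1" and "c < 0"
    and "\<forall>s. f s \<in> {- c / a<..}"
    and "\<forall>s. a * f s - c * ln (a * f s + c) = a\<^sup>2 * s + d"
  shows "proper_rotational_surface UNIV f g \<and> asymptotic_to_cylinder_at_bot f g (- c / a)"
proof
  note a = \<open>0 < a\<close> and c = \<open>c < 0\<close>
  have eq: "a * f s - c * ln (a * f s + c) = a\<^sup>2 * s + d" for s
    using assms(7) by simp
  have rot: "rotational_surface UNIV f g"
    using assms(1) by (simp add: rotational_ricci_surface_def)
  have f_pos: "f s > 0" for s
    using rot_pos[OF rot] by simp
  have y_pos: "a * f s + c > 0" for s
  proof -
    have "- c / a < f s"
      using assms(6) by simp
    thus ?thesis
      using a by (simp add: field_simps)
  qed
  have df: "deriv f s = a + c / f s" for s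
  proof -
    have "((\<lambda>s. a * f s - c * ln (a * f s + c)) has_real_derivative
        a * deriv f s - c * (a * deriv f s / (a * f s + c))) (at s)"
      using y_pos[of s] by (auto intro!: derivative_eq_intros rot_DERIV[OF rot])
    moreover have "((\<lambda>s. a * f s - c * ln (a * f s + c)) has_real_derivative a\<^sup>2) (at s)"
      unfolding eq by (auto intro!: derivative_eq_intros)
    ultimately have "a * deriv f s - c * (a * deriv f s / (a * f s + c)) = a\<^sup>2"
      by (rule DERIV_unique)
    \<comment> \<open>After multiplication by \<open>a * f s + c\<close> the two terms in
      \<open>c * deriv f s\<close> cancel.\<close>
    hence "a * (a * (f s * deriv f s)) = a * (a * (a * f s + c))"
      using y_pos[of s] by (simp add: field_simps power2_eq_square)
    hence "f s * deriv f s = a * f s + c"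
      using a by simp
    thus ?thesis
      using f_pos[of s] by (simp add: field_simps)
  qed
  have f_lim: "(f \<longlongrightarrow> - c / a) at_bot"
  proof -
    have le: "a * f s + c \<le> exp ((a\<^sup>2 * s + d) / - c)" for s
    proof -
      have "- c * ln (a * f s + c) \<le> a\<^sup>2 * s + d"
        using eq[of s] mult_pos_pos[OF a f_pos[of s]] by simp
      hence "ln (a * f s + c) \<le> (a\<^sup>2 * s + d) / - c"
        using c by (simp add: field_simps)
      thus ?thesis
        using y_pos[of s] by (metis exp_le_cancel_iff exp_ln)
    qed
    \<comment> \<open>The exponent is affine in \<open>s\<close>, with positive slope because
      \<open>c < 0\<close>.\<close>
    have "filterlim (\<lambda>s. (a\<^sup>2 * s + d) / - c) at_bot at_bot"
    proof (rule filterlim_at_bot_at_bot_if_deriv_ge)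
      show "((\<lambda>s. (a\<^sup>2 * s + d) / - c) has_real_derivative a\<^sup>2 / - c) (at s)" for s
        using c by (auto intro!: derivative_eq_intros)
      show "a\<^sup>2 / - c > 0"
        using a c by (intro divide_pos_pos) auto
    qed auto
    hence exp_lim: "((\<lambda>s. exp ((a\<^sup>2 * s + d) / - c)) \<longlongrightarrow> 0) at_bot"
      by (rule filterlim_compose[OF exp_at_bot])
    have "((\<lambda>s. a * f s + c) \<longlongrightarrow> 0) at_bot"
    proof (rule tendsto_sandwich[OF _ _ tendsto_const exp_lim])
      show "\<forall>\<^sub>F s in at_bot. 0 \<le> a * f s + c"
        by (intro always_eventually allI less_imp_le y_pos)
      show "\<forall>\<^sub>F s in at_bot. a * f s + c \<le> exp ((a\<^sup>2 * s + d) / - c)"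
        by (intro always_eventually allI le)
    qed
    hence "((\<lambda>s. ((a * f s + c) - c) / a) \<longlongrightarrow> (0 - c) / a) at_bot"
      using a by (intro tendsto_intros) auto
    thus ?thesis
      using a by simp
  qed
  have g_lim: "filterlim g at_bot at_bot"
  proof (rule filterlim_at_bot_at_bot_if_deriv_ge)
    show "(g has_real_derivative deriv g s) (at s)" for s
      by (rule rot_DERIV[OF rot]) simp
    \<comment> \<open>The limit of \<open>f\<close> is nonzero, so the quotient converges; the value
      is \<open>a - a = 0\<close>.\<close>
    have "((\<lambda>s. a + c / f s) \<longlongrightarrow> a + c / (- c / a)) at_bot"
      using a c by (intro tendsto_intros f_lim) auto
    hence "((\<lambda>s. (deriv f s)\<^sup>2) \<longlongrightarrow> 0\<^sup>2) at_bot"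
      unfolding df using c by (intro tendsto_intros) simp
    \<comment> \<open>The bound is \<open>1 - (1 / 2)\<^sup>2\<close>, so that unit speed gives
      \<open>(deriv g s)\<^sup>2 > 1 / 4\<close>; the sign of \<open>deriv g s\<close> then allows
      taking roots.\<close>
    hence "\<forall>\<^sub>F s in at_bot. (deriv f s)\<^sup>2 < 3 / 4"
      by (rule order_tendstoD) simp
    thus "\<forall>\<^sub>F s in at_bot. 1 / 2 \<le> deriv g s"
    proof eventually_elim
      case (elim s)
      hence "(1 / 2)\<^sup>2 \<le> (deriv g s)\<^sup>2"
        using rot_unit[OF rot, of s] by (simp add: power2_eq_square)
      thus ?case
        using rot by (intro power2_le_imp_le[of "1 / 2"]) (simp_all add: rotational_surface_def)
    qed
  qed simp
  show "asymptotic_to_cylinder_at_bot f g (- c / a)"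
    using f_lim g_lim by (simp add: asymptotic_to_cylinder_at_bot_def)
  show "proper_rotational_surface UNIV f g"
  proof (rule proper_rotational_surfaceI[OF rot])
    fix M
    \<comment> \<open>Subtracting 1 makes \<open>g s < - M\<close> strict, so no
      \<open>s \<le> A\<close> satisfies \<open>\<bar>g s\<bar> \<le> M\<close>.\<close>
    obtain A where A: "\<And>s. s \<le> A \<Longrightarrow> g s \<le> - \<bar>M\<bar> - 1"
      using g_lim by (auto simp: filterlim_at_bot eventually_at_bot_linorder)
    \<comment> \<open>The right endpoint is the parameter that the implicit equation assigns to the
      value \<open>M\<close>. The logarithm is harmless:
      \<open>0 < a * f s + c \<le> a * M + c\<close> once such an \<open>s\<close> exists.\<close>
    have "s \<in> {A..(a * M - c * ln (a * M + c) - d) / a\<^sup>2}" if "\<bar>f s\<bar> \<le> M" "\<bar>g s\<bar> \<le> M" for s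
    proof -
      have "A \<le> s"
        using A[of s] that(2) by linarith
      have fM: "a * f s \<le> a * M"
        using a that(1) by (intro mult_left_mono) auto
      hence "ln (a * f s + c) \<le> ln (a * M + c)"
        using y_pos[of s] by (subst ln_le_cancel_iff) auto
      hence "- c * ln (a * f s + c) \<le> - c * ln (a * M + c)"
        using c by (intro mult_left_mono) auto
      hence "a\<^sup>2 * s + d \<le> a * M - c * ln (a * M + c)"
        using eq[of s] fM by linarith
      thus ?thesis
        using a \<open>A \<le> s\<close> by (simp add: field_simps)
    qed
    hence "{s. \<bar>f s\<bar> \<le> M \<and> \<bar>g s\<bar> \<le> M} \<subseteq> {A..(a * M - c * ln (a * M + c) - d) / a\<^sup>2}"
      by blast
    thus "bounded {s. \<bar>f s\<bar> \<le> M \<and> \<bar>g s\<bar> \<le> M}"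
      by (rule bounded_subset[OF bounded_closed_interval])
  qed
qed

end
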